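(* Every graph in $\varepsilon_{01}$ has a node of degree $2$.
   Context: All graphs are finite, simple and connected. An Euler graph is a connected graph all of whose nodes have even degree. A cycle of length $n$ is of type $i$ if $n\equiv i\pmod 4$. $\varepsilon_{01}$ is the class of Euler graphs in which every cycle has length $\equiv 0$ or $\equiv 1\pmod 4$ and which contain at least one cycle of each of the types $0$ and $1$. *)

theory Defs
  imports "Graph_Theory.Digraph_Component" "HOL-Number_Theory.Cong"
begin

text \<open>
  A finite simple graph is a \<^locale>\<open>pair_graph\<close>: a finite vertex set with a symmetric irreflexive
  arc relation, each undirected edge being a pair of opposite arcs. The degree of a node is
  therefore its out-degree. Connectedness, which excludes the null graph, is
  \<^const>\<open>Digraph_Component.connected\<close>.
\<close>

definition euler_graph :: "'a pair_pre_digraph \<Rightarrow> bool" where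
  "euler_graph G \<longleftrightarrow> pair_graph G \<and> Digraph_Component.connected (with_proj G) \<and>
     (\<forall>v \<in> pverts G. even (out_degree (with_proj G) v))"

text \<open>
  For symmetric digraphs \<^const>\<open>pre_digraph.cycle\<close> also admits the walk \<open>u, v, u\<close> along a single
  edge, which is not a cycle of the undirected graph; the length bound removes exactly these walks.
\<close>

definition graph_cycle :: "'a pair_pre_digraph \<Rightarrow> ('a \<times> 'a) list \<Rightarrow> bool" where
  "graph_cycle G p \<longleftrightarrow> pre_digraph.cycle (with_proj G) p \<and> 3 \<le> length p"

definition cycle_of_type :: "'a pair_pre_digraph \<Rightarrow> nat \<Rightarrow> ('a \<times> 'a) list \<Rightarrow> bool" where
  "cycle_of_type G i p \<longleftrightarrow> graph_cycle G p \<and> [length p = i] (mod 4)"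

definition eps01 :: "'a pair_pre_digraph set" where
  "eps01 = {G. euler_graph G \<and>
     (\<forall>p. graph_cycle G p \<longrightarrow> cycle_of_type G 0 p \<or> cycle_of_type G 1 p) \<and>
     (\<exists>p. cycle_of_type G 0 p) \<and> (\<exists>p. cycle_of_type G 1 p)}"

end

theory Submission
  imports Defs "Graph_Theory.Vertex_Walk"
begin

text \<open>
  Let \<open>v\<^sub>0, v\<^sub>1, \<dots>\<close> be a longest path. Every neighbour of \<open>v\<^sub>0\<close> lies on it, and two neighbours
  \<open>v\<^sub>i\<close> and \<open>v\<^sub>j\<close> with \<open>i < j\<close> close a cycle of length \<open>j - i + 2\<close> through \<open>v\<^sub>0\<close>. If all cycle lengths
  are 0 or 1 modulo 4, every such difference \<open>j - i\<close> is 2 or 3 modulo 4. Among three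
  indices, additivity forces both consecutive differences to be 3; among four, the outer
  difference is then 1 modulo 4, which is impossible. Hence \<open>v\<^sub>0\<close> has degree at most 3, and evenness
  leaves only degree 2.
\<close>

lemma ex_diff_mod_4:
  fixes N :: "nat set"
  assumes "4 \<le> card N"
  obtains i j where "i \<in> N" "j \<in> N" "i < j" "(j - i) mod 4 \<in> {0, 1}"
proof -
  let ?xs = "sorted_list_of_set N"
  have fin: "finite N"
    using assms by (metis card.infinite not_numeral_le_zero)
  have "Suc (Suc (Suc (Suc 0))) \<le> length ?xs"
    using assms by simp
  then obtain a b c d ys where xs: "?xs = a # b # c # d # ys"
    unfolding Suc_le_length_iff by auto
  have N: "a \<in> N" "b \<in> N" "c \<in> N" "d \<in> N"
    using set_sorted_list_of_set[OF fin] unfolding xs by auto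
  have lt: "a < b" "b < c" "c < d"
    using strict_sorted_list_of_set[of N] unfolding xs by auto
  have add: "(k - i) mod 4 = ((j - i) mod 4 + (k - j) mod 4) mod 4" if "i < j" "j < k" for i j k :: nat
  proof -
    have "k - i = (j - i) + (k - j)"
      using that by simp
    then show ?thesis
      by (simp only: mod_add_eq)
  qed
  have "\<exists>i\<in>N. \<exists>j\<in>N. i < j \<and> (j - i) mod 4 \<in> {0, 1}"
  proof (rule ccontr)
    assume none: "\<not> ?thesis"
    have mod: "(j - i) mod 4 = 2 \<or> (j - i) mod 4 = 3" if "i \<in> N" "j \<in> N" "i < j" for i j
    proof -
      have "(j - i) mod 4 \<notin> {0, 1}"
        using none that by metis
      moreover have "(j - i) mod 4 < 4"
        by simp
      ultimately show ?thesis
        unfolding insert_iff empty_iff by linarith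
    qed
    \<comment> \<open>The sums 2+2, 2+3 and 3+2 leave residue 0 or 1 for \<open>k - i\<close>, which
      is excluded; only 3+3, with residue 2, survives.\<close>
    have three: "(j - i) mod 4 = 3 \<and> (k - j) mod 4 = 3"
      if "i \<in> N" "j \<in> N" "k \<in> N" "i < j" "j < k" for i j k
    proof -
      have "i < k"
        using that by simp
      show ?thesis
        using mod[OF that(1,2,4)] mod[OF that(2,3,5)] mod[OF that(1,3) \<open>i < k\<close>] add[OF that(4,5)]
        by (elim disjE) simp_all
    qed
    \<comment> \<open>In the triple a, b, c the number \<open>c - a\<close> is the outer difference,
      hence 3+3 mod 4; in a, c, d it is a consecutive one, hence 3.\<close>
    have "(c - a) mod 4 = 2"
      using add[OF lt(1,2)] three[OF N(1-3) lt(1,2)] by simp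
    moreover have "(c - a) mod 4 = 3"
      using three[OF N(1,3,4)] lt by simp
    ultimately show False by simp
  qed
  then show thesis
    by (elim bexE conjE) (rule that)
qed

text \<open>Paths are handled as node lists, whereas \<open>cycle\<close> speaks of arc lists; this
  lemma and the next translate. \<open>pcas\<close> only checks that consecutive arcs fit together,
  so membership in a graph does not enter.\<close>

lemma pcas_vwalk_arcs: "pcas u (vwalk_arcs (u # xs)) (last (u # xs))"
  by (induction xs arbitrary: u) auto

lemma pawalk_verts_vwalk_arcs: "pawalk_verts u (vwalk_arcs (u # xs)) = u # xs"
  by (induction xs arbitrary: u) auto

text \<open>Appending \<open>hd xs\<close> repeats only the start node, so the tail of the node list
  stays distinct, as \<open>cycle\<close> demands. The closed walk has as many arcs as
  \<open>xs\<close> has nodes.\<close>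

lemma graph_cycle_if_vpath_closes:
  assumes "vpath xs (with_proj G)" "3 \<le> length xs" "(last xs, hd xs) \<in> parcs G"
  shows "graph_cycle G (vwalk_arcs (xs @ [hd xs]))"
proof -
  obtain u ys where xs: "xs = u # ys" "ys \<noteq> []"
    using assms(2) by (cases xs; cases "tl xs") auto
  let ?p = "vwalk_arcs (u # ys @ [u])"
  have "set ?p \<subseteq> parcs G" "u \<in> pverts G" "distinct (u # ys)"
    using assms(1,3) vwalk_arcs_append[of "u # ys" "[u]"]
    unfolding xs(1) by (auto simp: vpath_def vwalk_def)
  moreover have "3 \<le> length ?p"
    using assms(2) vwalk_length_simp[of "u # ys @ [u]"]
    unfolding xs(1) vwalk_length_def by simp
  moreover have "pcas u ?p u" "pawalk_verts u ?p = u # ys @ [u]"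
    using pcas_vwalk_arcs[of u "ys @ [u]"] pawalk_verts_vwalk_arcs[of u "ys @ [u]"] by simp_all
  ultimately have "graph_cycle G ?p"
    unfolding graph_cycle_def pre_digraph.cycle_def pre_digraph.awalk_def
      cas_with_proj_eq awalk_verts_with_proj_eq
    by (intro conjI exI[of _ u]) auto
  then show ?thesis
    unfolding xs(1) by simp
qed

lemma vpath_infix:
  assumes "vpath (xs @ ys @ zs) G" "ys \<noteq> []"
  shows "vpath ys G"
  using assms vwalkI_append_l[of ys zs G] vwalkI_append_r[of "ys @ zs" xs G]
  by (auto simp: vpath_def)

context pair_graph
begin

text \<open>A finite graph has finitely many vertex paths, so their lengths are bounded. Comparison
  with \<open>q\<close> later ensures that the longest path has at least two nodes.\<close>

lemma ex_longest_vpath: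
  assumes "vpath q (with_proj G)"
  obtains p where "vpath p (with_proj G)" "length q \<le> length p"
    "\<And>r. vpath r (with_proj G) \<Longrightarrow> length r \<le> length p"
proof -
  have "finite {r. vpath r (with_proj G)}"
    by (rule vpaths_finite)
  then have "\<forall>r. vpath r (with_proj G) \<longrightarrow> length r < Suc (Max (length ` {r. vpath r (with_proj G)}))"
    by (simp add: less_Suc_eq_le)
  from ex_has_greatest_nat[of "\<lambda>r. vpath r (with_proj G)" q length, OF assms this]
  obtain p where "vpath p (with_proj G)" "\<And>r. vpath r (with_proj G) \<Longrightarrow> length r \<le> length p"
    by auto
  with assms show thesis
    by (intro that[of p])
qed

text \<open>The cycle runs from \<open>hd p\<close> to \<open>p ! i\<close>, along \<open>p\<close>
  to \<open>p ! j\<close>, and back. The segment has \<open>j - i + 1\<close> nodes, and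
  \<open>0 < i\<close> keeps \<open>hd p\<close> out of it because \<open>p\<close> is
  distinct.\<close>

lemma graph_cycle_through_hd:
  assumes p: "vpath p (with_proj G)"
    and ij: "0 < i" "i < j" "j < length p"
    and arcs: "(hd p, p ! i) \<in> parcs G" "(hd p, p ! j) \<in> parcs G"
  obtains c where "graph_cycle G c" "length c = j - i + 2"
proof -
  let ?ys = "drop i (take (Suc j) p)"
  let ?xs = "hd p # ?ys"
  have ys: "?ys \<noteq> []" "hd ?ys = p ! i" "last ?ys = p ! j"
    using ij by (auto simp: hd_drop_conv_nth last_conv_nth)
  have "p = take i p @ ?ys @ drop (Suc j) p"
    using ij by (metis append.assoc append_take_drop_id less_SucI less_imp_le_nat min.absorb1 take_take)
  then have path: "vpath ?ys (with_proj G)"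
    using vpath_infix[OF _ ys(1)] p by metis
  have "hd p \<notin> set (drop i p)"
    using p ij by (cases p; cases i) (auto simp: vpath_def dest: in_set_dropD)
  then have "hd p \<notin> set ?ys"
    by (metis drop_take in_set_takeD)
  then have "vpath ?xs (with_proj G)"
    using path arcs(1) ys by (auto simp: vpath_def intro!: vwalk_consI dest: wellformed')
  moreover have "(last ?xs, hd ?xs) \<in> parcs G"
    using arcs(2) ys arcs_symmetric by auto
  moreover have len: "length ?xs = j - i + 2"
    using ij by simp
  ultimately have "graph_cycle G (vwalk_arcs (?xs @ [hd ?xs]))"
    using ij by (intro graph_cycle_if_vpath_closes) auto
  moreover have "length (vwalk_arcs (?xs @ [hd ?xs])) = j - i + 2"
    using vwalk_length_simp[of "?xs @ [hd ?xs]"] len unfolding vwalk_length_def by simp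
  ultimately show thesis by (rule that)
qed

text \<open>A neighbour off the path could be prepended, giving a longer path. Since path nodes are
  distinct, neighbours of \<open>hd p\<close> correspond to their indices.\<close>

lemma out_degree_hd_longest_vpath:
  assumes p: "vpath p (with_proj G)"
    and longest: "\<And>r. vpath r (with_proj G) \<Longrightarrow> length r \<le> length p"
  shows "out_degree (with_proj G) (hd p) = card {i. i < length p \<and> (hd p, p ! i) \<in> parcs G}"
    (is "_ = card ?N")
proof -
  have on_path: "w \<in> set p" if "(hd p, w) \<in> parcs G" for w
  proof (rule ccontr)
    assume "w \<notin> set p"
    then have "vpath (w # p) (with_proj G)"
      using p that arcs_symmetric by (auto simp: vpath_def intro!: vwalk_consI dest: wellformed')
    from longest[OF this] show False by simp
  qed
  have "bij_betw (\<lambda>i. (hd p, p ! i)) ?N (out_arcs (with_proj G) (hd p))"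
    unfolding bij_betw_def
  proof
    show "inj_on (\<lambda>i. (hd p, p ! i)) ?N"
      using p by (auto simp: inj_on_def vpath_def nth_eq_iff_index_eq)
    show "(\<lambda>i. (hd p, p ! i)) ` ?N = out_arcs (with_proj G) (hd p)"
      using on_path by (force simp: in_set_conv_nth)
  qed
  then show ?thesis
    by (simp add: out_degree_def bij_betw_same_card)
qed

lemma ex_graph_cycle_mod_4:
  assumes "parcs G \<noteq> {}"
    and deg: "\<And>v. v \<in> pverts G \<Longrightarrow> out_degree (with_proj G) v \<noteq> 0 \<Longrightarrow> 4 \<le> out_degree (with_proj G) v"
  obtains c where "graph_cycle G c" "length c mod 4 \<in> {2, 3}"
proof -
  obtain u v where uv: "(u, v) \<in> parcs G"
    using assms(1) by auto
  then have "vpath [u, v] (with_proj G)"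
    using pair_no_loops[OF uv] by (auto simp: vpath_def vwalk_def dest: wellformed')
  then obtain p where p: "vpath p (with_proj G)" "length [u, v] \<le> length p"
    and longest: "\<And>r. vpath r (with_proj G) \<Longrightarrow> length r \<le> length p"
    using ex_longest_vpath by blast
  let ?N = "{i. i < length p \<and> (hd p, p ! i) \<in> parcs G}"
  obtain x y zs where xyz: "p = x # y # zs"
    using p(2) by (cases p; cases "tl p") auto
  \<comment> \<open>The second node of the path is a neighbour of the first, so the degree is not 0
    and \<open>deg\<close> applies.\<close>
  then have "1 \<in> ?N" and hd: "hd p \<in> pverts G"
    using p(1) by (auto simp: vpath_def vwalk_def)
  then have "card ?N \<noteq> 0"
    by auto
  then have "4 \<le> card ?N"
    using deg[OF hd] out_degree_hd_longest_vpath[OF p(1) longest] by simp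
  then obtain i j where ij: "i \<in> ?N" "j \<in> ?N" "i < j" "(j - i) mod 4 \<in> {0, 1}"
    by (rule ex_diff_mod_4)
  moreover have "i \<noteq> 0"
    using ij(1) pair_no_loops[of "(hd p, p ! i)"] xyz by (cases i) auto
  ultimately obtain c where "graph_cycle G c" "length c = j - i + 2"
    using graph_cycle_through_hd[OF p(1), of i j] by auto
  \<comment> \<open>The two arcs at \<open>hd p\<close> shift the residues 0 and 1 to the forbidden
    2 and 3.\<close>
  moreover have "(j - i + 2) mod 4 \<in> {2, 3}"
    using ij(4) mod_add_eq[of "j - i" 4 2, symmetric] by auto
  ultimately show thesis
    using that by simp
qed

end

theorem theorem4:
  fixes G :: "'a pair_pre_digraph"
  assumes "G \<in> eps01"
  shows "\<exists>v \<in> pverts G. out_degree (with_proj G) v = 2"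
proof (rule ccontr)
  assume no_deg_2: "\<not> ?thesis"
  interpret pair_graph G
    using assms by (simp add: eps01_def euler_graph_def)
  obtain p where "graph_cycle G p"
    using assms by (auto simp: eps01_def cycle_of_type_def)
  then have "parcs G \<noteq> {}"
    by (cases p) (auto simp: graph_cycle_def cycle_def awalk_def)
  \<comment> \<open>Evenness and the absence of degree 2 leave 0 as the only value below 4.\<close>
  moreover have "4 \<le> out_degree (with_proj G) v"
    if "v \<in> pverts G" "out_degree (with_proj G) v \<noteq> 0" for v
  proof -
    have "even (out_degree (with_proj G) v)" "out_degree (with_proj G) v \<noteq> 2"
      using assms no_deg_2 that(1) by (auto simp: eps01_def euler_graph_def)
    with that(2) show ?thesis by presburger
  qed
  ultimately obtain c where c: "graph_cycle G c" "length c mod 4 \<in> {2, 3}"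
    by (rule ex_graph_cycle_mod_4)
  then have "length c mod 4 \<in> {0, 1}"
    using assms by (auto simp: eps01_def cycle_of_type_def cong_def)
  with c(2) show False by auto
qed

end
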